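(* Let $(X,e)$ be a quasi-metric space and let $T:X\to X$ be a continuous map. Then $$h''_e(T)\le h'_e(T).$$
   Context: A quasi-metric on a set $X$ is a function $e:X\times X\to[0,+\infty)$ such that for all $x,y,z\in X$: $e(x,y)\ge 0$; $e(x,y)=0$ if and only if $x=y$; and $e(x,z)\le e(x,y)+e(y,z)$ (symmetry is not required). The space $X$ carries the topology generated by the sets $B_t(p)=\{x\in X: e(x,p)<t \text{ and } e(p,x)<t\}$, $p\in X$, $t>0$; continuity and compactness refer to this topology. For $n\ge 1$ put $e_n(x,y)=\max_{0\le i\le n-1}e(T^i(x),T^i(y))$. Let $K\subseteq X$ be compact and $\epsilon>0$. A subset $F\subseteq X$ is an $(n,\epsilon)$-spanning set of $K$ with respect to $T$ if for every $x\in K$ there is $y\in F$ with $e_n(x,y)\le\epsilon$ and $e_n(y,x)\le\epsilon$; $r'_n(\epsilon,K,T,e)$ is the smallest cardinality of such a set, and $$h'_e(T)=\sup_K\lim_{\epsilon\to 0}\limsup_{n\to\infty}\frac{\log r'_n(\epsilon,K,T,e)}{n}.$$ A subset $F\subseteq X$ is an $(\epsilon,n)$-spanning set of $K$ with respect to $T$ (note the reversed order of the parameters) if for every $x\in K$ there is $y\in F$ with $e_n(x,y)\le\epsilon$ or $e_n(y,x)\le\epsilon$; $r''_n(\epsilon,K,T,e)$ is the smallest cardinality of such a set, and $$h''_e(T)=\sup_K\lim_{\epsilon\to 0}\limsup_{n\to\infty}\frac{\log r''_n(\epsilon,K,T,e)}{n}.$$ Both suprema are over all compact subsets $K$ of $X$.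 Entropies take extended real values, with the convention $\log 0=-\infty$ (relevant only for $K=\emptyset$). *)

theory Defs
  imports "HOL-Analysis.Analysis"
begin

definition quasi_metric_on :: "'a set \<Rightarrow> ('a \<Rightarrow> 'a \<Rightarrow> real) \<Rightarrow> bool" where
  "quasi_metric_on X e \<longleftrightarrow>
     (\<forall>x\<in>X. \<forall>y\<in>X. 0 \<le> e x y) \<and>
     (\<forall>x\<in>X. \<forall>y\<in>X. e x y = 0 \<longleftrightarrow> x = y) \<and>
     (\<forall>x\<in>X. \<forall>y\<in>X. \<forall>z\<in>X. e x z \<le> e x y + e y z)"

definition qball :: "'a set \<Rightarrow> ('a \<Rightarrow> 'a \<Rightarrow> real) \<Rightarrow> real \<Rightarrow> 'a \<Rightarrow> 'a set" where
  "qball X e t p = {x \<in> X. e x p < t \<and> e p x < t}"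

definition qtopology :: "'a set \<Rightarrow> ('a \<Rightarrow> 'a \<Rightarrow> real) \<Rightarrow> 'a topology" where
  "qtopology X e = topology_generated_by {qball X e t p | t p. p \<in> X \<and> 0 < t}"

text \<open>Only meaningful for \<open>n \<ge> 1\<close>; for \<open>n = 0\<close> the value is unspecified,
  which does not affect the limits superior below.\<close>

definition bowen :: "('a \<Rightarrow> 'a) \<Rightarrow> ('a \<Rightarrow> 'a \<Rightarrow> real) \<Rightarrow> nat \<Rightarrow> 'a \<Rightarrow> 'a \<Rightarrow> real" where
  "bowen T e n x y = Max ((\<lambda>i. e ((T ^^ i) x) ((T ^^ i) y)) ` {..<n})"

definition spanning_and ::
  "'a set \<Rightarrow> ('a \<Rightarrow> 'a \<Rightarrow> real) \<Rightarrow> ('a \<Rightarrow> 'a) \<Rightarrow> 'a set \<Rightarrow> nat \<Rightarrow> real \<Rightarrow> 'a set \<Rightarrow> bool" where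
  "spanning_and X e T K n \<epsilon> F \<longleftrightarrow>
     F \<subseteq> X \<and> (\<forall>x\<in>K. \<exists>y\<in>F. bowen T e n x y \<le> \<epsilon> \<and> bowen T e n y x \<le> \<epsilon>)"

definition spanning_or ::
  "'a set \<Rightarrow> ('a \<Rightarrow> 'a \<Rightarrow> real) \<Rightarrow> ('a \<Rightarrow> 'a) \<Rightarrow> 'a set \<Rightarrow> nat \<Rightarrow> real \<Rightarrow> 'a set \<Rightarrow> bool" where
  "spanning_or X e T K n \<epsilon> F \<longleftrightarrow>
     F \<subseteq> X \<and> (\<forall>x\<in>K. \<exists>y\<in>F. bowen T e n x y \<le> \<epsilon> \<or> bowen T e n y x \<le> \<epsilon>)"

definition ecard :: "'a set \<Rightarrow> enat" where
  "ecard F = (if finite F then enat (card F) else \<infinity>)"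

text \<open>\<^const>\<open>Inf\<close> on a nonempty set of extended naturals is its least element.\<close>

definition r_and ::
  "'a set \<Rightarrow> ('a \<Rightarrow> 'a \<Rightarrow> real) \<Rightarrow> ('a \<Rightarrow> 'a) \<Rightarrow> 'a set \<Rightarrow> nat \<Rightarrow> real \<Rightarrow> enat" where
  "r_and X e T K n \<epsilon> = Inf (ecard ` {F. spanning_and X e T K n \<epsilon> F})"

definition r_or ::
  "'a set \<Rightarrow> ('a \<Rightarrow> 'a \<Rightarrow> real) \<Rightarrow> ('a \<Rightarrow> 'a) \<Rightarrow> 'a set \<Rightarrow> nat \<Rightarrow> real \<Rightarrow> enat" where
  "r_or X e T K n \<epsilon> = Inf (ecard ` {F. spanning_or X e T K n \<epsilon> F})"

text \<open>The library's \<^const>\<open>ln\<close> has \<open>ln 0 = 0\<close> on the reals; here \<open>log 0 = -\<infinity>\<close>.\<close>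

definition elog :: "enat \<Rightarrow> ereal" where
  "elog r = (case r of enat k \<Rightarrow> if k = 0 then -\<infinity> else ereal (ln (real k)) | \<infinity> \<Rightarrow> \<infinity>)"

text \<open>The one-sided limits at \<open>0\<close> exist, because the limits superior are
  antimonotone in \<open>\<epsilon>\<close>.\<close>

definition entropy_and :: "'a set \<Rightarrow> ('a \<Rightarrow> 'a \<Rightarrow> real) \<Rightarrow> ('a \<Rightarrow> 'a) \<Rightarrow> ereal" where
  "entropy_and X e T =
     (SUP K \<in> {K. compactin (qtopology X e) K}.
        Lim (at_right 0) (\<lambda>\<epsilon>. limsup (\<lambda>n. elog (r_and X e T K n \<epsilon>) / ereal (real n))))"

definition entropy_or :: "'a set \<Rightarrow> ('a \<Rightarrow> 'a \<Rightarrow> real) \<Rightarrow> ('a \<Rightarrow> 'a) \<Rightarrow> ereal" where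
  "entropy_or X e T =
     (SUP K \<in> {K. compactin (qtopology X e) K}.
        Lim (at_right 0) (\<lambda>\<epsilon>. limsup (\<lambda>n. elog (r_or X e T K n \<epsilon>) / ereal (real n))))"

end

theory Submission
  imports Defs
begin

text \<open>A set that approximates every orbit of \<open>K\<close> up to \<open>\<epsilon>\<close> in both directions of the quasi-metric
  approximates it in at least one, so the infimum defining \<open>r_or\<close> is taken over a larger family than
  the one defining \<open>r_and\<close>, and \<open>r_or \<le> r_and\<close> for all \<open>K\<close>, \<open>n\<close> and \<open>\<epsilon>\<close>. It remains to carry this
  inequality through the logarithm, the limit superior, the limit at \<open>0\<close> and the supremum, all of
  which are monotone.

  The one step that needs an argument is the limit at \<open>0\<close>: \<^const>\<open>Lim\<close> respects inequalities only
  between functions that converge. Enlarging \<open>\<epsilon>\<close> makes spanning easier, so both exponential growth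
  rates are antimonotone in \<open>\<epsilon>\<close>, and an antimonotone function into a complete linear order tends from
  the right to the supremum of its values. The comparison of limits thus becomes a comparison of
  suprema.\<close>

lemma Lim_at_right_antimono:
  fixes f :: "real \<Rightarrow> 'b::{complete_linorder, linorder_topology}"
  assumes anti: "\<And>x y. a < x \<Longrightarrow> x \<le> y \<Longrightarrow> f y \<le> f x"
  shows "Lim (at_right a) f = (SUP x\<in>{a<..}. f x)"
proof (rule tendsto_Lim)
  show "(f \<longlongrightarrow> (SUP x\<in>{a<..}. f x)) (at_right a)"
  proof (rule order_tendstoI)
    fix l assume "l < (SUP x\<in>{a<..}. f x)"
    then obtain x where x: "a < x" "l < f x"
      by (auto simp: less_SUP_iff)
    then have "\<And>y. a < y \<Longrightarrow> y < x \<Longrightarrow> l < f y"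
      using anti by (meson less_imp_le less_le_trans)
    then show "\<forall>\<^sub>F y in at_right a. l < f y"
      using x(1) by (auto simp: eventually_at_right_field)
  next
    fix u assume u: "(SUP x\<in>{a<..}. f x) < u"
    have "f y < u" if "a < y" for y
      by (rule le_less_trans[OF SUP_upper u]) (use that in simp)
    then show "\<forall>\<^sub>F y in at_right a. f y < u"
      by (simp add: eventually_at_filter)
  qed
qed simp

lemma elog_mono: "r \<le> s \<Longrightarrow> elog r \<le> elog s"
  by (auto simp: elog_def split: enat.splits)

lemma limsup_elog_div_mono:
  assumes "\<And>n. r n \<le> s n"
  shows "limsup (\<lambda>n. elog (r n) / ereal (real n)) \<le> limsup (\<lambda>n. elog (s n) / ereal (real n))"
  unfolding divide_ereal_def
  by (intro Limsup_mono always_eventually allI ereal_mult_right_mono elog_mono assms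
      inverse_ereal_ge0I) simp

lemma spanning_and_imp_spanning_or:
  "spanning_and X e T K n \<epsilon> F \<Longrightarrow> spanning_or X e T K n \<epsilon> F"
  unfolding spanning_and_def spanning_or_def by blast

lemma spanning_and_mono:
  "\<epsilon> \<le> \<delta> \<Longrightarrow> spanning_and X e T K n \<epsilon> F \<Longrightarrow> spanning_and X e T K n \<delta> F"
  unfolding spanning_and_def by (meson order_trans)

lemma spanning_or_mono:
  "\<epsilon> \<le> \<delta> \<Longrightarrow> spanning_or X e T K n \<epsilon> F \<Longrightarrow> spanning_or X e T K n \<delta> F"
  unfolding spanning_or_def by (meson order_trans)

lemma r_or_le_r_and: "r_or X e T K n \<epsilon> \<le> r_and X e T K n \<epsilon>"
  unfolding r_or_def r_and_def
  by (intro INF_superset_mono) (auto intro: spanning_and_imp_spanning_or)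

lemma r_and_antimono: "\<epsilon> \<le> \<delta> \<Longrightarrow> r_and X e T K n \<delta> \<le> r_and X e T K n \<epsilon>"
  unfolding r_and_def by (intro INF_superset_mono) (auto intro: spanning_and_mono)

lemma r_or_antimono: "\<epsilon> \<le> \<delta> \<Longrightarrow> r_or X e T K n \<delta> \<le> r_or X e T K n \<epsilon>"
  unfolding r_or_def by (intro INF_superset_mono) (auto intro: spanning_or_mono)

theorem theorem4p1:
  fixes X :: "'a set" and e :: "'a \<Rightarrow> 'a \<Rightarrow> real" and T :: "'a \<Rightarrow> 'a"
  assumes "quasi_metric_on X e"
    and "continuous_map (qtopology X e) (qtopology X e) T"
  shows "entropy_or X e T \<le> entropy_and X e T"
  unfolding entropy_or_def entropy_and_def
proof (rule SUP_mono', goal_cases)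
  case (1 K)
  let ?h_or = "\<lambda>\<epsilon>. limsup (\<lambda>n. elog (r_or X e T K n \<epsilon>) / ereal (real n))"
  let ?h_and = "\<lambda>\<epsilon>. limsup (\<lambda>n. elog (r_and X e T K n \<epsilon>) / ereal (real n))"
  have "Lim (at_right 0) ?h_or = (SUP \<epsilon>\<in>{0<..}. ?h_or \<epsilon>)"
    by (intro Lim_at_right_antimono limsup_elog_div_mono r_or_antimono)
  also have "\<dots> \<le> (SUP \<epsilon>\<in>{0<..}. ?h_and \<epsilon>)"
    by (intro SUP_mono' limsup_elog_div_mono r_or_le_r_and)
  also have "\<dots> = Lim (at_right 0) ?h_and"
    by (intro Lim_at_right_antimono[symmetric] limsup_elog_div_mono r_and_antimono)
  finally show ?case .
qed

end
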